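(* Let $v,w$ be words over $[\pm n]$. Then $v\sim w$ if and only if $v^\star\sim w^\star$.
   Context: $[\pm n]=\{1,\dots,n,\overline n,\dots,\overline 1\}$ ($\overline i=-i$, $\overline{\overline i}=i$), ordered $1<\dots<n<\overline n<\dots<\overline 1$. For a word $w=w_1\cdots w_k$, $w^\star=\overline{w_k}\cdots\overline{w_1}$. A column is a strictly increasing word; it is admissible if whenever $i,\overline i$ both occur, with $i$ at position $a$ from the beginning and $\overline i$ at position $b$ from the end, $a+b\le i$. Knuth equivalence $\sim$ is the congruence on the free monoid over $[\pm n]$ generated by (applied to factors): (K1) $\gamma\beta\alpha\sim\beta\gamma\alpha$ if $\gamma<\alpha\le\beta$ and $(\beta,\gamma)\ne(\overline x,x)$ for all $x\in[n]$; (K2) $\alpha\beta\gamma\sim\alpha\gamma\beta$ if $\gamma\le\alpha<\beta$ and $(\beta,\gamma)\ne(\overline x,x)$; (K3) $(y+1)\,\overline{y+1}\,\beta\sim\overline y\,y\,\beta$ if $y<\beta<\overline y$, $y\in[n-1]$; (K4) $\beta\,\overline y\,y\sim\beta\,(y+1)\,\overline{y+1}$ if $y<\beta<\overline y$, $y\in[n-1]$; (K5) $u\sim u\setminus\{z,\overline z\}$ if $u$ is a strictly increasing word that is not an admissible column, every proper factor of $u$ is an admissible column, and $z$ is the least $z\in[n]$ such that $z,\overline z\in u$ and $u$ has more than $z$ letters of absolute value $\le z$. *)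

theory Defs
  imports Main "HOL-Library.Sublist"
begin

text \<open>
  Letters of the alphabet \<open>[\<plusminus>n]\<close> are nonzero integers, the bar of \<open>i\<close> being \<open>- i\<close>;
  words are lists, written from left to right.
\<close>

definition letters :: "nat \<Rightarrow> int set" where
  "letters n = {x. x \<noteq> 0 \<and> \<bar>x\<bar> \<le> int n}"

text \<open>
  The order \<open>1 < \<dots> < n < -n < \<dots> < -1\<close>: unbarred letters precede barred ones, and on each of the two
  kinds it is the usual order of the integers.
\<close>

definition letter_less :: "int \<Rightarrow> int \<Rightarrow> bool"  (infix "\<prec>" 50) where
  "x \<prec> y \<longleftrightarrow> (0 < x \<and> y < 0) \<or> ((0 < x \<longleftrightarrow> 0 < y) \<and> x < y)"

definition letter_le :: "int \<Rightarrow> int \<Rightarrow> bool"  (infix "\<preceq>" 50) where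
  "x \<preceq> y \<longleftrightarrow> x = y \<or> x \<prec> y"

definition star :: "int list \<Rightarrow> int list" where
  "star w = rev (map uminus w)"

definition column :: "nat \<Rightarrow> int list \<Rightarrow> bool" where
  "column n u \<longleftrightarrow> u \<in> lists (letters n) \<and> sorted_wrt (\<prec>) u"

text \<open>The 1-based positions are \<open>a = Suc p\<close> from the beginning and \<open>b = Suc q\<close> from the end.\<close>

definition admissible :: "nat \<Rightarrow> int list \<Rightarrow> bool" where
  "admissible n u \<longleftrightarrow> column n u \<and>
     (\<forall>i p q. 0 < i \<and> p < length u \<and> q < length u \<and> u ! p = i \<and> rev u ! q = - i
        \<longrightarrow> int (Suc p + Suc q) \<le> i)"

definition crowded :: "nat \<Rightarrow> int list \<Rightarrow> int \<Rightarrow> bool" where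
  "crowded n u z \<longleftrightarrow> 1 \<le> z \<and> z \<le> int n \<and> z \<in> set u \<and> - z \<in> set u \<and>
     z < int (length (filter (\<lambda>x. \<bar>x\<bar> \<le> z) u))"

inductive knuth_rel :: "nat \<Rightarrow> int list \<Rightarrow> int list \<Rightarrow> bool" for n :: nat where
  K1: "\<lbrakk>{\<alpha>, \<beta>, \<gamma>} \<subseteq> letters n; \<gamma> \<prec> \<alpha>; \<alpha> \<preceq> \<beta>; \<forall>x\<in>{1..int n}. (\<beta>, \<gamma>) \<noteq> (- x, x)\<rbrakk>
         \<Longrightarrow> knuth_rel n [\<gamma>, \<beta>, \<alpha>] [\<beta>, \<gamma>, \<alpha>]"
| K2: "\<lbrakk>{\<alpha>, \<beta>, \<gamma>} \<subseteq> letters n; \<gamma> \<preceq> \<alpha>; \<alpha> \<prec> \<beta>; \<forall>x\<in>{1..int n}. (\<beta>, \<gamma>) \<noteq> (- x, x)\<rbrakk>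
         \<Longrightarrow> knuth_rel n [\<alpha>, \<beta>, \<gamma>] [\<alpha>, \<gamma>, \<beta>]"
| K3: "\<lbrakk>1 \<le> y; y < int n; \<beta> \<in> letters n; y \<prec> \<beta>; \<beta> \<prec> - y\<rbrakk>
         \<Longrightarrow> knuth_rel n [y + 1, - (y + 1), \<beta>] [- y, y, \<beta>]"
| K4: "\<lbrakk>1 \<le> y; y < int n; \<beta> \<in> letters n; y \<prec> \<beta>; \<beta> \<prec> - y\<rbrakk>
         \<Longrightarrow> knuth_rel n [\<beta>, - y, y] [\<beta>, y + 1, - (y + 1)]"
| K5: "\<lbrakk>column n u; \<not> admissible n u; \<forall>f. strict_sublist f u \<longrightarrow> admissible n f;
         crowded n u z; \<forall>z'. crowded n u z' \<longrightarrow> z \<le> z'\<rbrakk>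
         \<Longrightarrow> knuth_rel n u (filter (\<lambda>x. x \<noteq> z \<and> x \<noteq> - z) u)"

inductive knuth_equiv :: "nat \<Rightarrow> int list \<Rightarrow> int list \<Rightarrow> bool" for n :: nat where
  rel: "knuth_rel n u v \<Longrightarrow> knuth_equiv n u v"
| refl: "u \<in> lists (letters n) \<Longrightarrow> knuth_equiv n u u"
| sym: "knuth_equiv n u v \<Longrightarrow> knuth_equiv n v u"
| trans: "\<lbrakk>knuth_equiv n u v; knuth_equiv n v w\<rbrakk> \<Longrightarrow> knuth_equiv n u w"
| append: "\<lbrakk>knuth_equiv n u v; knuth_equiv n u' v'\<rbrakk> \<Longrightarrow> knuth_equiv n (u @ u') (v @ v')"

end

theory Submission
  imports Defs
begin

text \<open>
  Barring reverses the order of the letters, so \<open>star\<close> maps columns to columns and interchanges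
  positions from the beginning with positions from the end; admissibility is symmetric in the two.
  Hence \<open>star\<close> maps relations K1 to K2, K3 to K4 and K5 to K5, and it is an involution.
\<close>

lemma star_star [simp]: "star (star w) = w"
  by (simp add: star_def rev_map o_def)

lemma star_append: "star (u @ v) = star v @ star u"
  by (simp add: star_def)

lemma set_star: "set (star u) = uminus ` set u"
  by (simp add: star_def)

lemma rev_star: "rev (star u) = map uminus u"
  by (simp add: star_def)

lemma length_star [simp]: "length (star u) = length u"
  by (simp add: star_def)

text \<open>Serves two predicates invariant under barring: absolute value at most \<open>z\<close>,
  which \<open>crowded\<close> counts, and being neither \<open>z\<close> nor \<open>- z\<close>,
  which K5 filters by.\<close>

lemma filter_star:
  assumes "\<And>x. P (- x) \<longleftrightarrow> P x"
  shows "filter P (star u) = star (filter P u)"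
  by (induction u) (simp_all add: star_def assms)

lemma uminus_letters_iff [simp]: "- x \<in> letters n \<longleftrightarrow> x \<in> letters n"
  by (simp add: letters_def)

lemma star_lists_iff [simp]: "star u \<in> lists (letters n) \<longleftrightarrow> u \<in> lists (letters n)"
  by (auto simp: in_lists_conv_set set_star)

text \<open>The hypotheses exclude 0, where barring fails to reverse the relation: -1 \<prec> 0
  holds but 0 \<prec> 1 does not.\<close>

lemma letter_less_uminus:
  assumes "x \<in> letters n" "y \<in> letters n"
  shows "- x \<prec> - y \<longleftrightarrow> y \<prec> x"
  using assms by (auto simp: letters_def letter_less_def)

lemma letter_le_uminus:
  assumes "x \<in> letters n" "y \<in> letters n"
  shows "- x \<preceq> - y \<longleftrightarrow> y \<preceq> x"
  using letter_less_uminus[OF assms] by (auto simp: letter_le_def)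

lemma column_star:
  assumes "column n u"
  shows "column n (star u)"
proof -
  have u: "u \<in> lists (letters n)" and s: "sorted_wrt (\<prec>) u"
    using assms by (auto simp: column_def)
  \<comment> \<open>This is sortedness of \<open>star u\<close> pulled back to \<open>u\<close>
    through \<open>rev\<close> and \<open>map\<close>.\<close>
  have "sorted_wrt (\<lambda>x y. - y \<prec> - x) u"
    by (rule sorted_wrt_mono_rel[OF _ s]) (use u letter_less_uminus in blast)
  with u show ?thesis
    by (simp add: column_def star_def sorted_wrt_rev sorted_wrt_map in_lists_conv_set)
qed

lemma admissible_star:
  assumes "admissible n u"
  shows "admissible n (star u)"
  unfolding admissible_def
proof (intro conjI allI impI)
  show "column n (star u)"
    using assms column_star by (simp add: admissible_def)
next
  fix i p q
  assume a: "0 < i \<and> p < length (star u) \<and> q < length (star u) \<and> star u ! p = i \<and> rev (star u) ! q = - i"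
  \<comment> \<open>The offending pair keeps its letter \<open>i\<close>, while \<open>p\<close> and
    \<open>q\<close> trade places, so the sum of the positions is unchanged.\<close>
  then have "u ! q = i" and "rev u ! p = - i"
    by (auto simp: rev_star) (auto simp: star_def rev_map)
  with a assms have "int (Suc q + Suc p) \<le> i"
    unfolding admissible_def by (metis length_star)
  then show "int (Suc p + Suc q) \<le> i"
    by simp
qed

lemma strict_sublist_star:
  assumes "strict_sublist f (star u)"
  shows "strict_sublist (star f) u"
proof -
  from assms obtain ps ss where *: "star u = ps @ f @ ss" and ne: "f \<noteq> star u"
    by (auto simp: strict_sublist_def sublist_def)
  from * have "u = star ss @ star f @ star ps"
    by (metis append.assoc star_append star_star)
  then have "sublist (star f) u"
    by (auto simp: sublist_def)
  moreover have "star f \<noteq> u"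
    using ne by auto
  ultimately show ?thesis
    by (simp add: strict_sublist_def)
qed

text \<open>The condition is symmetric in \<open>z\<close> and \<open>- z\<close> and otherwise
  depends only on absolute values. Hence the least crowded \<open>z\<close> is the same for
  \<open>u\<close> and \<open>star u\<close>, and K5 deletes the same pair from both.\<close>

lemma crowded_star [simp]: "crowded n (star u) z \<longleftrightarrow> crowded n u z"
proof -
  have "z \<in> set (star u) \<longleftrightarrow> - z \<in> set u" "- z \<in> set (star u) \<longleftrightarrow> z \<in> set u"
    by (force simp: set_star)+
  then show ?thesis
    by (auto simp: crowded_def filter_star)
qed

text \<open>The conclusion uses \<open>knuth_equiv\<close> because \<open>star\<close> turns an
  instance of K1 to K4 into an instance of the partner rule read from right to left; only K5 keeps
  its direction.\<close>

lemma knuth_rel_star: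
  assumes "knuth_rel n u v"
  shows "knuth_equiv n (star u) (star v)"
  using assms
proof cases
  case (K1 \<alpha> \<beta> \<gamma>)
  \<comment> \<open>The largest and smallest letters trade roles under barring, and an excluded pair
    (- x, x) is sent to itself.\<close>
  have ne: "\<forall>x\<in>{1..int n}. (- \<gamma>, - \<beta>) \<noteq> (- x, x)"
    using K1(6) by (metis Pair_inject minus_minus)
  \<comment> \<open>The chain \<gamma> \<prec> \<alpha> \<preceq> \<beta> becomes - \<beta>
    \<preceq> - \<alpha> \<prec> - \<gamma>, with the weak and strict signs placed as K2
    demands.\<close>
  have "knuth_rel n [- \<alpha>, - \<gamma>, - \<beta>] [- \<alpha>, - \<beta>, - \<gamma>]"
    by (rule knuth_rel.K2[OF _ _ _ ne]) (use K1(3-5) in \<open>auto simp: letter_less_uminus letter_le_uminus\<close>)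
  then have "knuth_equiv n (star v) (star u)"
    using K1(1,2) by (simp add: star_def knuth_equiv.rel)
  then show ?thesis
    by (rule knuth_equiv.sym)
next
  case (K2 \<alpha> \<beta> \<gamma>)
  have ne: "\<forall>x\<in>{1..int n}. (- \<gamma>, - \<beta>) \<noteq> (- x, x)"
    using K2(6) by (metis Pair_inject minus_minus)
  have "knuth_rel n [- \<beta>, - \<gamma>, - \<alpha>] [- \<gamma>, - \<beta>, - \<alpha>]"
    by (rule knuth_rel.K1[OF _ _ _ ne]) (use K2(3-5) in \<open>auto simp: letter_less_uminus letter_le_uminus\<close>)
  then have "knuth_equiv n (star v) (star u)"
    using K2(1,2) by (simp add: star_def knuth_equiv.rel)
  then show ?thesis
    by (rule knuth_equiv.sym)
next
  case (K3 y \<beta>)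
  \<comment> \<open>The same \<open>y\<close> works: \<open>star\<close> fixes both two-letter
    blocks, and the interval between \<open>y\<close> and \<open>- y\<close> is closed under
    barring.\<close>
  have "knuth_rel n [- \<beta>, - y, y] [- \<beta>, y + 1, - (y + 1)]"
    by (rule knuth_rel.K4) (use K3 in \<open>auto simp: letters_def letter_less_def\<close>)
  then have "knuth_equiv n [- \<beta>, y + 1, - (y + 1)] [- \<beta>, - y, y]"
    by (rule knuth_equiv.sym[OF knuth_equiv.rel])
  then show ?thesis
    using K3(1,2) by (simp add: star_def add.commute)
next
  case (K4 y \<beta>)
  have "knuth_rel n [y + 1, - (y + 1), - \<beta>] [- y, y, - \<beta>]"
    by (rule knuth_rel.K3) (use K4 in \<open>auto simp: letters_def letter_less_def\<close>)
  then have "knuth_equiv n [- y, y, - \<beta>] [y + 1, - (y + 1), - \<beta>]"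
    by (rule knuth_equiv.sym[OF knuth_equiv.rel])
  then show ?thesis
    using K4(1,2) by (simp add: star_def add.commute)
next
  case (K5 z)
  have "knuth_rel n (star u) (filter (\<lambda>x. x \<noteq> z \<and> x \<noteq> - z) (star u))"
  proof (rule knuth_rel.K5)
    show "column n (star u)"
      using K5 by (simp add: column_star)
    show "\<not> admissible n (star u)"
      \<comment> \<open>If \<open>star u\<close> were admissible, so would be its own star, which is
        \<open>u\<close>.\<close>
      using K5 admissible_star[of n "star u"] by auto
    show "\<forall>f. strict_sublist f (star u) \<longrightarrow> admissible n f"
      using K5 strict_sublist_star admissible_star by (metis star_star)
  qed (use K5 in auto)
  also have "filter (\<lambda>x. x \<noteq> z \<and> x \<noteq> - z) (star u) = star v"
    using K5(1) by (subst filter_star) auto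
  finally show ?thesis
    by (rule knuth_equiv.rel)
qed

lemma knuth_equiv_star:
  assumes "knuth_equiv n u v"
  shows "knuth_equiv n (star u) (star v)"
  using assms
proof induction
  case (rel u v)
  then show ?case by (simp add: knuth_rel_star)
next
  case (refl u)
  then show ?case by (simp add: knuth_equiv.refl)
next
  case (sym u v)
  show ?case by (rule knuth_equiv.sym[OF sym.IH])
next
  case (trans u v w)
  show ?case by (rule knuth_equiv.trans[OF trans.IH])
next
  case (append u v u' v')
  then show ?case by (simp add: star_append knuth_equiv.append)
qed

theorem theorem5p8:
  fixes n :: nat and v w :: "int list"
  assumes "v \<in> lists (letters n)" and "w \<in> lists (letters n)"
  shows "knuth_equiv n v w \<longleftrightarrow> knuth_equiv n (star v) (star w)"
  using knuth_equiv_star[of n v w] knuth_equiv_star[of n "star v" "star w"] by auto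

end
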